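(* For every $x\in\mathbb{R}^d$ and every open ball $O\subset\mathbb{R}^d$ that is relatively compact, $$\limsup_{h\to 0^+} h\log P_1^h[1_O](x)\le -\inf_{y\in O} l(x,y).$$
   Context: Let $g:\mathbb{R}\setminus\{0\}\to\mathbb{R}^+$ be a smooth function with compact support in $[-1,1]$ such that $\int_{\mathbb{R}}(z^2\wedge 1)g(z)\,dz<\infty$, and such that on a neighborhood of $0$ one has $g(z)=C/|z|^{1+\alpha}$ for some constant $C>0$ and some $\alpha\in(0,1)$. Let $\gamma:\mathbb{R}\to\mathbb{R}^d$ be a smooth curve with bounded derivatives of each order and $\gamma(0)=0$. Assume that there exists $k$ such that the vectors $\frac{d^j\gamma}{dz^j}(0)$, $j\le k$, span $\mathbb{R}^d$. Let $\mu$ be the image of the measure $g(z)\,dz$ under $\gamma$, i.e. $\int (f(x+z')-f(x))\,\mu(dz')=\int_{\mathbb{R}}(f(x+\gamma(z))-f(x))g(z)\,dz$ for $f\in C_b^\infty(\mathbb{R}^d)$. For $\xi\in\mathbb{R}^d$ put $H(\xi)=\int_{\mathbb{R}^d}(\exp[\langle z',\xi\rangle]-1)\,\mu(dz')$, and for $a\in\mathbb{R}^d$ let $L(a)=\sup_{\xi\in\mathbb{R}^d}\{\langle a,\xi\rangle-H(\xi)\}$ be its Legendre transform. For a piecewise $C^1$ curve $\phi:[0,1]\to\mathbb{R}^d$ put $S(\phi)=\int_0^1 L(\frac{d}{dt}\phi(t))\,dt$, and put $l(x,y)=\inf\{S(\phi):\phi(0)=x,\ \phi(1)=y\}$, the infimum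 being over piecewise $C^1$ curves. For $h>0$ let $\mathcal{L}^hf(x)=\int_{\mathbb{R}^d}(f(x+hz')-f(x))\,\mu(dz')$ for smooth $f$ with bounded derivatives of each order, and let $(P_t^h)_{t\ge 0}$ be the Markov semi-group generated by $\frac1h\mathcal{L}^h$. It is given by probability measures, so that $P_1^h[1_O](x)$ is the mass given to $O$ by the measure at time $1$ starting from $x$. Convention: $\log 0=-\infty$. *)

theory Defs
  imports "HOL-Probability.Probability"
begin

definition nth_deriv :: "nat \<Rightarrow> (real \<Rightarrow> 'a::real_normed_vector) \<Rightarrow> real \<Rightarrow> 'a" where
  "nth_deriv n f = ((\<lambda>u t. vector_derivative u (at t)) ^^ n) f"

(* The derivatives are two-sided, so S is required to be open. *)
definition smooth_on_open :: "real set \<Rightarrow> (real \<Rightarrow> 'a::real_normed_vector) \<Rightarrow> bool" where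
  "smooth_on_open S f \<longleftrightarrow> open S \<and> (\<forall>n. \<forall>t\<in>S. nth_deriv n f differentiable (at t))"

definition iter_deriv :: "'a list \<Rightarrow> ('a::euclidean_space \<Rightarrow> real) \<Rightarrow> 'a \<Rightarrow> real" where
  "iter_deriv vs f = foldr (\<lambda>v u x. frechet_derivative u (at x) v) vs f"

(* The space of smooth functions that are bounded together with all their derivatives.
   The empty list of directions makes f itself bounded. *)
definition Cb_infinity :: "('a::euclidean_space \<Rightarrow> real) set" where
  "Cb_infinity = {f. \<forall>vs. (\<forall>x. iter_deriv vs f differentiable (at x)) \<and>
                          bounded (range (iter_deriv vs f))}"

(* The value of g at 0, where the density is not defined in the mathematics, is irrelevant:
   it is charged by a null set only. *)
definition image_measure :: "(real \<Rightarrow> real) \<Rightarrow> (real \<Rightarrow> 'a::euclidean_space) \<Rightarrow> 'a measure" where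
  "image_measure g \<gamma> = distr (density lborel (\<lambda>z. ennreal (g z))) borel \<gamma>"

definition hamiltonian :: "'a::euclidean_space measure \<Rightarrow> 'a \<Rightarrow> real" where
  "hamiltonian \<mu> \<xi> = (\<integral>z. (exp (z \<bullet> \<xi>) - 1) \<partial>\<mu>)"

definition lagrangian :: "'a::euclidean_space measure \<Rightarrow> 'a \<Rightarrow> ereal" where
  "lagrangian \<mu> a = (SUP \<xi>. ereal (a \<bullet> \<xi> - hamiltonian \<mu> \<xi>))"

(* The Lagrangian is nonnegative (take the covector 0 in the supremum, where the
   Hamiltonian vanishes), so e2ennreal loses nothing.  The finitely many points
   where the derivative may not exist are a null set. *)
definition action :: "'a::euclidean_space measure \<Rightarrow> (real \<Rightarrow> 'a) \<Rightarrow> ennreal" where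
  "action \<mu> \<phi> =
     (\<integral>\<^sup>+t\<in>{0..1}. e2ennreal (lagrangian \<mu> (vector_derivative \<phi> (at t))) \<partial>lborel)"

definition action_dist :: "'a::euclidean_space measure \<Rightarrow> 'a \<Rightarrow> 'a \<Rightarrow> ennreal" where
  "action_dist \<mu> x y =
     (INF \<phi>\<in>{\<phi>. \<phi> piecewise_C1_differentiable_on {0..1} \<and> \<phi> 0 = x \<and> \<phi> 1 = y}.
        action \<mu> \<phi>)"

definition jump_operator ::
    "'a::euclidean_space measure \<Rightarrow> real \<Rightarrow> ('a \<Rightarrow> real) \<Rightarrow> 'a \<Rightarrow> real" where
  "jump_operator \<mu> h f x = (\<integral>z. (f (x + h *\<^sub>R z) - f x) \<partial>\<mu>)"

(* P t x is the law at time t of the process started from x. *)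
definition markov_semigroup :: "(real \<Rightarrow> 'a::euclidean_space \<Rightarrow> 'a measure) \<Rightarrow> bool" where
  "markov_semigroup P \<longleftrightarrow>
     (\<forall>t\<ge>0. P t \<in> borel \<rightarrow>\<^sub>M prob_algebra borel) \<and>
     (\<forall>x. P 0 x = return borel x) \<and>
     (\<forall>s\<ge>0. \<forall>t\<ge>0. \<forall>x. P (s + t) x = P s x \<bind> P t)"

(* The infinitesimal generator of P is defined on Cb_infinity, as a limit in the supremum
   norm, and agrees there with A. *)
definition generated_by ::
    "(real \<Rightarrow> 'a::euclidean_space \<Rightarrow> 'a measure) \<Rightarrow> (('a \<Rightarrow> real) \<Rightarrow> 'a \<Rightarrow> real) \<Rightarrow> bool" where
  "generated_by P A \<longleftrightarrow>
     (\<forall>f\<in>Cb_infinity.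
        uniform_limit UNIV (\<lambda>t x. ((\<integral>y. f y \<partial>P t x) - f x) / t) (A f) (at_right 0))"

(* Only used for p \<ge> 0; the library's real logarithm has ln 0 = 0. *)
definition ext_ln :: "real \<Rightarrow> ereal" where
  "ext_ln p = (if p = 0 then - \<infinity> else ereal (ln p))"

end

theory Submission
  imports Defs "HOL-Computational_Algebra.Polynomial"
begin

text \<open>The process started from \<open>x\<close> has independent stationary increments, so the bound is that of
  Cramer's theorem.  If \<open>X\<close> has the law \<open>P h 1 x\<close>, then the exponential moment of
  \<open>(X - x) \<bullet> \<xi> / h\<close> is at most \<open>exp (hamiltonian \<mu> \<xi> / h)\<close>
  (\<open>semigroup_exponential_moment\<close>), and Chebyshev's inequality gives, for every covector \<open>\<xi>\<close>
  and every closed ball \<open>K\<close>, that \<open>h * ln (P h 1 x K)\<close> is at most minus the minimum over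
  \<open>y \<in> K\<close> of \<open>(y - x) \<bullet> \<xi> - hamiltonian \<mu> \<xi>\<close>.  By convexity of the Hamiltonian and a
  minimax principle (\<open>convex_minimax_cball\<close>), optimizing in \<open>\<xi>\<close> yields minus the infimum over
  \<open>K\<close> of the Lagrangian at \<open>y - x\<close>.  Since straight segments are admissible, the Lagrangian at
  \<open>y - x\<close> is at least \<open>action_dist \<mu> x y\<close>, which gives the bound for closed balls.  The estimate
  is valid for each \<open>h\<close> without prefactor, so exhausting the open ball by closed balls preserves
  it (\<open>semigroup_ball_le\<close>).

  The moment bound is the analytic core, because the semigroup is only known through its
  generator on bounded smooth functions, whereas exponentials are unbounded.  They are
  approximated by logistic functions \<open>f = q / (1 + \<epsilon> q)\<close>, \<open>q = exp (y \<bullet> \<eta>)\<close>.  Concavity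
  in \<open>q\<close> makes the generator \<open>A\<close> satisfy \<open>A f \<le> \<beta> f (1 - \<epsilon> f)\<close>, where \<open>\<beta>\<close> is the
  rate expected for the exponential itself.  A Gronwall inequality (\<open>semigroup_gronwall\<close>) first
  gives a crude bound of rate \<open>\<bar>\<beta>\<bar>\<close>; the crude bound for the covector \<open>2 *\<^sub>R \<eta>\<close> controls the
  error \<open>\<bar>\<beta>\<bar> \<epsilon> f\<^sup>2\<close>, and a second use of the inequality, followed by \<open>\<epsilon> \<rightarrow> 0\<close>, gives
  the exact rate.\<close>

section \<open>Markov semigroups and a Gronwall inequality\<close>

lemma markov_semigroup_measurable:
  assumes "markov_semigroup P" "0 \<le> t"
  shows "P t \<in> borel \<rightarrow>\<^sub>M prob_algebra borel"
  using assms unfolding markov_semigroup_def by blast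

lemma markov_semigroup_prob_space:
  assumes "markov_semigroup P" "0 \<le> t"
  shows "prob_space (P t x)" and "sets (P t x) = sets borel" and "space (P t x) = UNIV"
proof -
  have "P t x \<in> space (prob_algebra borel)"
    using markov_semigroup_measurable[OF assms] by (rule measurable_space) simp
  then show "prob_space (P t x)" and s: "sets (P t x) = sets borel"
    by (auto simp: space_prob_algebra)
  show "space (P t x) = UNIV"
    using sets_eq_imp_space_eq[OF s] by simp
qed

lemma markov_semigroup_integrable:
  fixes f :: "'a::euclidean_space \<Rightarrow> real"
  assumes "markov_semigroup P" "0 \<le> t"
    and "f \<in> borel_measurable borel" "\<And>y. \<bar>f y\<bar> \<le> B"
  shows "integrable (P t x) f"
proof -
  interpret prob_space "P t x" using markov_semigroup_prob_space[OF assms(1,2)] by simp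
  have "f \<in> borel_measurable (P t x)"
    using assms(3) markov_semigroup_prob_space(2)[OF assms(1,2)]
    by (simp cong: measurable_cong_sets)
  then show ?thesis
    by (rule integrable_const_bound[where B=B, rotated]) (simp add: assms(4))
qed

lemma markov_semigroup_measurable_integral:
  fixes f :: "'a::euclidean_space \<Rightarrow> real"
  assumes "markov_semigroup P" "0 \<le> t" and [measurable]: "f \<in> borel_measurable borel"
  shows "(\<lambda>x. \<integral>y. f y \<partial>P t x) \<in> borel_measurable borel"
proof -
  have "P t \<in> borel \<rightarrow>\<^sub>M subprob_algebra borel"
    using markov_semigroup_measurable[OF assms(1,2)] by (rule measurable_prob_algebraD)
  then show ?thesis
    by (rule measurable_compose[OF _ integral_measurable_subprob_algebra]) simp
qed

lemma markov_semigroup_integral_add: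
  fixes f :: "'a::euclidean_space \<Rightarrow> real"
  assumes P: "markov_semigroup P" "0 \<le> s" "0 \<le> t"
    and f: "f \<in> borel_measurable borel" "\<And>y. \<bar>f y\<bar> \<le> B"
  shows "(\<integral>y. f y \<partial>P (s + t) x) = (\<integral>y. \<integral>z. f z \<partial>P t y \<partial>P s x)"
proof -
  have "P (s + t) x = P s x \<bind> P t"
    using P unfolding markov_semigroup_def by blast
  moreover interpret prob_space "P s x" using markov_semigroup_prob_space[OF P(1,2)] by simp
  have "P t \<in> P s x \<rightarrow>\<^sub>M subprob_algebra borel"
    using measurable_prob_algebraD[OF markov_semigroup_measurable[OF P(1,3)]]
      markov_semigroup_prob_space(2)[OF P(1,2)] by (simp cong: measurable_cong_sets)
  then have "integral\<^sup>L (P s x \<bind> P t) f = (\<integral>y. integral\<^sup>L (P t y) f \<partial>P s x)"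
    using f by (intro integral_bind[where K=borel and B=B and B'=1])
      (auto intro!: finite_measure_axioms AE_I2
         simp: prob_space.emeasure_space_1[OF markov_semigroup_prob_space(1)[OF P(1,3)]])
  ultimately show ?thesis by simp
qed

text \<open>The limit defining the generator is uniform in the starting point, so one time step
  \<open>s\<close> works for all points at once.  This is what lets the estimate be iterated along the
  chain sampled at multiples of \<open>s\<close>.\<close>
lemma generated_by_step:
  assumes P: "markov_semigroup P" "generated_by P A" "f \<in> Cb_infinity" "0 < \<delta>"
  shows "\<exists>d>0. \<forall>s. 0 < s \<longrightarrow> s < d \<longrightarrow> (\<forall>x. (\<integral>y. f y \<partial>P s x) \<le> f x + s * (A f x + \<delta>))"
proof -
  have "\<forall>\<^sub>F s in at_right 0. \<forall>x\<in>UNIV. dist (((\<integral>y. f y \<partial>P s x) - f x) / s) (A f x) < \<delta>"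
    using P(2-4) unfolding generated_by_def uniform_limit_iff by blast
  then obtain d where d: "d > 0"
    "\<And>s x. 0 < s \<Longrightarrow> s < d \<Longrightarrow> dist (((\<integral>y. f y \<partial>P s x) - f x) / s) (A f x) < \<delta>"
    unfolding eventually_at_right_field by auto
  have "(\<integral>y. f y \<partial>P s x) \<le> f x + s * (A f x + \<delta>)" if s: "0 < s" "s < d" for s x
  proof -
    have "((\<integral>y. f y \<partial>P s x) - f x) / s < A f x + \<delta>"
      using d(2)[OF s, of x] by (auto simp: dist_real_def)
    then show ?thesis using s by (simp add: field_simps)
  qed
  with d(1) show ?thesis by blast
qed

lemma Cb_infinity_basic:
  fixes f :: "'a::euclidean_space \<Rightarrow> real"
  assumes "f \<in> Cb_infinity"
  shows "f \<in> borel_measurable borel" and "\<exists>B. \<forall>y. \<bar>f y\<bar> \<le> B"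
proof -
  from assms have "\<forall>x. iter_deriv [] f differentiable (at x)" "bounded (range (iter_deriv [] f))"
    unfolding Cb_infinity_def by blast+
  then have d: "\<And>x. f differentiable (at x)" and b: "bounded (range f)"
    by (auto simp: iter_deriv_def)
  have "continuous_on UNIV f"
    using d by (intro continuous_at_imp_continuous_on) (auto intro: differentiable_imp_continuous_within)
  then show "f \<in> borel_measurable borel" by (rule borel_measurable_continuous_onI)
  show "\<exists>B. \<forall>y. \<bar>f y\<bar> \<le> B" using b by (auto simp: bounded_iff)
qed

text \<open>A Gronwall inequality that avoids differentiating \<open>t \<mapsto> P t f\<close>, for which \<open>A f\<close>
  would have to be studied as a function on its own.  Sampling at the multiples of
  \<open>\<tau> = t / n\<close> turns \<open>A f \<le> \<beta> f + e\<close> into the recursion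
  \<open>a (k + 1) \<le> (1 + \<beta> \<tau>) a k + \<tau> (\<kappa> + \<delta>)\<close>, where \<open>\<delta>\<close> absorbs the error made by
  replacing the generator with a difference quotient.\<close>
lemma semigroup_gronwall_defect:
  fixes f e :: "'a::euclidean_space \<Rightarrow> real"
  assumes P: "markov_semigroup P" "generated_by P A"
    and f: "f \<in> Cb_infinity" "\<And>y. 0 \<le> f y"
    and e: "e \<in> borel_measurable borel" "\<And>y. \<bar>e y\<bar> \<le> B"
    and Af: "\<And>y. A f y \<le> \<beta> * f y + e y"
    and t: "0 < t"
    and \<kappa>: "0 \<le> \<kappa>" "\<And>s. 0 \<le> s \<Longrightarrow> s \<le> t \<Longrightarrow> (\<integral>y. e y \<partial>P s x) \<le> \<kappa>"
    and \<delta>: "0 < \<delta>"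
  shows "(\<integral>y. f y \<partial>P t x) \<le> exp (\<beta> * t) * f x + t * exp (\<bar>\<beta>\<bar> * t) * (\<kappa> + \<delta>)"
proof -
  obtain Bf where fm: "f \<in> borel_measurable borel" and Bf: "\<And>y. \<bar>f y\<bar> \<le> Bf"
    using Cb_infinity_basic[OF f(1)] by blast
  obtain d where d: "d > 0" and
    step: "\<And>s y. 0 < s \<Longrightarrow> s < d \<Longrightarrow> (\<integral>z. f z \<partial>P s y) \<le> f y + s * (A f y + \<delta>)"
    using generated_by_step[OF P f(1) \<delta>] by blast
  \<comment> \<open>The step has to be shorter than \<open>d\<close>, and short enough for \<open>1 + \<beta> \<tau>\<close> to be
    nonnegative: only then may an upper bound for \<open>a k\<close> be inserted in the recursion.\<close>
  obtain n :: nat where n: "n > t / min d (1 / (\<bar>\<beta>\<bar> + 1))"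
    using reals_Archimedean2 by blast
  have m: "0 < min d (1 / (\<bar>\<beta>\<bar> + 1))" using d by simp
  then have n0: "0 < real n" using n t by (metis divide_pos_pos less_trans)
  define \<tau> where "\<tau> = t / n"
  have \<tau>: "0 < \<tau>" "n * \<tau> = t" using t n0 by (auto simp: \<tau>_def)
  have "\<tau> < min d (1 / (\<bar>\<beta>\<bar> + 1))"
    using n m n0 by (simp add: \<tau>_def pos_divide_less_eq mult.commute del: min_less_iff_conj)
  then have \<tau>d: "\<tau> < d" and "\<tau> * (\<bar>\<beta>\<bar> + 1) < 1" by (simp_all add: pos_less_divide_eq)
  then have "\<bar>\<beta> * \<tau>\<bar> < 1" using \<tau>(1) by (simp add: abs_mult algebra_simps)
  then have pos: "0 \<le> 1 + \<beta> * \<tau>" by linarith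
  have le_exp: "1 + \<beta> * \<tau> \<le> exp (\<beta> * \<tau>)" by (rule exp_ge_add_one_self)
  also have "\<dots> \<le> exp (\<bar>\<beta>\<bar> * \<tau>)" using \<tau>(1) by (simp add: mult_right_mono)
  finally have le_exp': "1 + \<beta> * \<tau> \<le> exp (\<bar>\<beta>\<bar> * \<tau>)" .
  define a where "a k = (\<integral>y. f y \<partial>P (real k * \<tau>) x)" for k
  have a_Suc: "a (Suc k) \<le> (1 + \<beta> * \<tau>) * a k + \<tau> * (\<kappa> + \<delta>)" if k: "k < n" for k
  proof -
    have k\<tau>: "0 \<le> k * \<tau>" "k * \<tau> \<le> t" using k \<tau> by (auto simp flip: \<tau>(2) intro!: mult_right_mono)
    note int = markov_semigroup_integrable[OF P(1) k\<tau>(1)]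
    interpret prob_space "P (k * \<tau>) x" using markov_semigroup_prob_space[OF P(1) k\<tau>(1)] by simp
    have i: "integrable (P (k * \<tau>) x) f" "integrable (P (k * \<tau>) x) e"
      using int[OF fm Bf] int[OF e] by auto
    have "a (Suc k) = (\<integral>y. \<integral>z. f z \<partial>P \<tau> y \<partial>P (k * \<tau>) x)"
      using markov_semigroup_integral_add[OF P(1) k\<tau>(1) less_imp_le[OF \<tau>(1)] fm Bf, of x]
      by (simp add: a_def algebra_simps)
    also have "\<dots> \<le> (\<integral>y. (1 + \<beta> * \<tau>) * f y + \<tau> * (e y + \<delta>) \<partial>P (k * \<tau>) x)"
    proof (rule integral_mono)
      show "integrable (P (k * \<tau>) x) (\<lambda>y. \<integral>z. f z \<partial>P \<tau> y)"
      proof (rule int)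
        show "(\<lambda>y. \<integral>z. f z \<partial>P \<tau> y) \<in> borel_measurable borel"
          using markov_semigroup_measurable_integral[OF P(1) _ fm] \<tau>(1) by simp
        fix y
        interpret Q: prob_space "P \<tau> y" using markov_semigroup_prob_space[OF P(1)] \<tau>(1) by simp
        have fi: "integrable (P \<tau> y) f"
          using markov_semigroup_integrable[OF P(1) _ fm Bf] \<tau>(1) by simp
        have "norm (\<integral>z. f z \<partial>P \<tau> y) \<le> (\<integral>z. norm (f z) \<partial>P \<tau> y)" by (rule integral_norm_bound)
        also have "\<dots> \<le> Bf" using Bf fi by (intro Q.integral_le_const) auto
        finally show "\<bar>\<integral>z. f z \<partial>P \<tau> y\<bar> \<le> Bf" by simp
      qed
      fix y
      have "(\<integral>z. f z \<partial>P \<tau> y) \<le> f y + \<tau> * (A f y + \<delta>)" using step \<tau> \<tau>d by blast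
      also have "\<dots> \<le> f y + \<tau> * (\<beta> * f y + e y + \<delta>)"
        using Af[of y] \<tau>(1) by (intro add_mono mult_left_mono) auto
      finally show "(\<integral>z. f z \<partial>P \<tau> y) \<le> (1 + \<beta> * \<tau>) * f y + \<tau> * (e y + \<delta>)"
        by (simp add: algebra_simps)
    qed (use i in auto)
    also have "\<dots> = (1 + \<beta> * \<tau>) * a k + \<tau> * ((\<integral>y. e y \<partial>P (k * \<tau>) x) + \<delta>)"
      using i by (simp add: a_def prob_space)
    also have "\<dots> \<le> (1 + \<beta> * \<tau>) * a k + \<tau> * (\<kappa> + \<delta>)"
      using \<kappa>(2)[OF k\<tau>] \<tau>(1) by (intro add_left_mono mult_left_mono) auto
    finally show ?thesis .
  qed
  \<comment> \<open>The growth of the main term keeps the sign of \<open>\<beta>\<close>, while the accumulated error is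
    estimated with \<open>\<bar>\<beta>\<bar>\<close>; this makes the error bound monotone in \<open>k\<close>.\<close>
  have "k \<le> n \<Longrightarrow> a k \<le> exp (\<beta> * (k * \<tau>)) * f x + (k * \<tau>) * exp (\<bar>\<beta>\<bar> * (k * \<tau>)) * (\<kappa> + \<delta>)" for k
  proof (induction k)
    case 0
    have "P 0 x = return borel x" using P(1) unfolding markov_semigroup_def by blast
    then show ?case using fm by (simp add: a_def integral_return)
  next
    case (Suc k)
    define q where "q = \<tau> * (\<kappa> + \<delta>)"
    define E where "E = exp (\<bar>\<beta>\<bar> * (k * \<tau>))"
    have q: "0 \<le> q" using \<tau>(1) \<kappa>(1) \<delta> by (simp add: q_def)
    have E: "1 \<le> E" using \<tau>(1) by (simp add: E_def)
    have E': "1 \<le> exp (\<bar>\<beta>\<bar> * \<tau>)" using \<tau>(1) by simp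
    have "a (Suc k) \<le> (1 + \<beta> * \<tau>) * a k + q" using a_Suc[of k] Suc.prems by (simp add: q_def)
    also have "\<dots> \<le> (1 + \<beta> * \<tau>) * (exp (\<beta> * (k * \<tau>)) * f x + k * E * q) + q"
      using Suc pos by (intro add_mono mult_left_mono) (auto simp: E_def q_def mult_ac)
    also have "\<dots> = (1 + \<beta> * \<tau>) * (exp (\<beta> * (k * \<tau>)) * f x) + (1 + \<beta> * \<tau>) * (k * E * q) + q"
      by (simp add: algebra_simps)
    also have "\<dots> \<le> exp (\<beta> * \<tau>) * (exp (\<beta> * (k * \<tau>)) * f x)
        + exp (\<bar>\<beta>\<bar> * \<tau>) * (k * E * q) + exp (\<bar>\<beta>\<bar> * \<tau>) * (E * q)"
    proof (intro add_mono)
      have "1 * 1 \<le> exp (\<bar>\<beta>\<bar> * \<tau>) * E" using E E' by (intro mult_mono) auto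
      then show "q \<le> exp (\<bar>\<beta>\<bar> * \<tau>) * (E * q)"
        using q mult_right_mono[of 1 "exp (\<bar>\<beta>\<bar> * \<tau>) * E" q] by (simp add: mult.assoc)
    qed (use le_exp le_exp' f(2) q E in \<open>auto intro!: mult_right_mono\<close>)
    also have "\<dots> = exp (\<beta> * (Suc k * \<tau>)) * f x + Suc k * exp (\<bar>\<beta>\<bar> * (Suc k * \<tau>)) * q"
      by (simp add: E_def algebra_simps exp_add)
    finally show ?case by (simp add: q_def mult_ac)
  qed
  from this[of n] show ?thesis by (simp add: a_def \<tau>(2))
qed

text \<open>The defect \<open>\<delta>\<close> was arbitrary and is now sent to \<open>0\<close>.\<close>
lemma semigroup_gronwall:
  fixes f e :: "'a::euclidean_space \<Rightarrow> real"
  assumes P: "markov_semigroup P" "generated_by P A"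
    and f: "f \<in> Cb_infinity" "\<And>y. 0 \<le> f y"
    and e: "e \<in> borel_measurable borel" "\<And>y. \<bar>e y\<bar> \<le> B"
    and Af: "\<And>y. A f y \<le> \<beta> * f y + e y"
    and t: "0 \<le> t"
    and \<kappa>: "0 \<le> \<kappa>" "\<And>s. 0 \<le> s \<Longrightarrow> s \<le> t \<Longrightarrow> (\<integral>y. e y \<partial>P s x) \<le> \<kappa>"
  shows "(\<integral>y. f y \<partial>P t x) \<le> exp (\<beta> * t) * f x + t * exp (\<bar>\<beta>\<bar> * t) * \<kappa>"
proof (cases "t = 0")
  case True
  have "P 0 x = return borel x" using P(1) unfolding markov_semigroup_def by blast
  then show ?thesis using True Cb_infinity_basic(1)[OF f(1)] by (simp add: integral_return)
next
  case False
  with t have t: "0 < t" by simp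
  show ?thesis
  proof (rule field_le_epsilon)
    fix \<epsilon> :: real assume \<epsilon>: "0 < \<epsilon>"
    define \<delta> where "\<delta> = \<epsilon> / (t * exp (\<bar>\<beta>\<bar> * t))"
    have "0 < \<delta>" using \<epsilon> t by (simp add: \<delta>_def)
    from semigroup_gronwall_defect[OF P f e Af t \<kappa> this]
    show "(\<integral>y. f y \<partial>P t x) \<le> exp (\<beta> * t) * f x + t * exp (\<bar>\<beta>\<bar> * t) * \<kappa> + \<epsilon>"
      using t by (simp add: \<delta>_def distrib_left)
  qed
qed

section \<open>Bounded smooth approximations of exponentials\<close>

text \<open>The generator is known on bounded functions only, so \<open>q = exp (y \<bullet> \<eta>)\<close> is replaced by
  \<open>q / (1 + \<epsilon> q)\<close>, a scaled logistic function, which increases to \<open>q\<close> as \<open>\<epsilon>\<close> decreases to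
  \<open>0\<close>.  It is a concave function of \<open>q\<close>, and it solves the logistic equation.\<close>
definition tamed_exp :: "real \<Rightarrow> 'a::euclidean_space \<Rightarrow> 'a \<Rightarrow> real" where
  "tamed_exp \<epsilon> \<eta> y = exp (y \<bullet> \<eta>) / (1 + \<epsilon> * exp (y \<bullet> \<eta>))"

lemma tamed_exp_denominator: "0 < \<epsilon> \<Longrightarrow> 0 < 1 + \<epsilon> * exp (s::real)"
  by (simp add: add_pos_pos)

lemma tamed_exp_bounds:
  assumes "0 < \<epsilon>"
  shows "0 < tamed_exp \<epsilon> \<eta> y" "tamed_exp \<epsilon> \<eta> y \<le> 1 / \<epsilon>" "tamed_exp \<epsilon> \<eta> y \<le> exp (y \<bullet> \<eta>)"
  using assms tamed_exp_denominator[OF assms, of "y \<bullet> \<eta>"]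
  by (auto simp: tamed_exp_def field_simps)

lemma tamed_exp_has_derivative:
  assumes "0 < \<epsilon>"
  shows "(tamed_exp \<epsilon> \<eta> has_derivative
           (\<lambda>v. tamed_exp \<epsilon> \<eta> y * (1 - \<epsilon> * tamed_exp \<epsilon> \<eta> y) * (v \<bullet> \<eta>))) (at y)"
proof -
  have nz: "1 + \<epsilon> * exp (y \<bullet> \<eta>) \<noteq> 0" using tamed_exp_denominator[OF assms] by (metis less_irrefl)
  let ?D = "1 + \<epsilon> * exp (y \<bullet> \<eta>)"
  have "1 - \<epsilon> * tamed_exp \<epsilon> \<eta> y = 1 / ?D"
    using nz by (simp add: tamed_exp_def diff_divide_eq_iff)
  then have eq: "tamed_exp \<epsilon> \<eta> y * (1 - \<epsilon> * tamed_exp \<epsilon> \<eta> y) = exp (y \<bullet> \<eta>) / (?D * ?D)"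
    by (simp add: tamed_exp_def)
  have "((\<lambda>y. exp (y \<bullet> \<eta>) / (1 + \<epsilon> * exp (y \<bullet> \<eta>))) has_derivative
           (\<lambda>v. exp (y \<bullet> \<eta>) / (?D * ?D) * (v \<bullet> \<eta>))) (at y)"
    by (rule derivative_eq_intros refl nz)+ (simp add: fun_eq_iff algebra_simps)
  then show ?thesis unfolding eq by (simp add: tamed_exp_def[abs_def])
qed

text \<open>By the logistic equation, differentiation in a fixed direction maps the polynomials in
  \<open>tamed_exp \<epsilon> \<eta>\<close> to themselves.  Boundedness of all derivatives then follows from the
  boundedness of \<open>tamed_exp \<epsilon> \<eta>\<close> alone.\<close>
lemma iter_deriv_tamed_exp:
  assumes "0 < \<epsilon>"
  shows "\<exists>p. iter_deriv vs (tamed_exp \<epsilon> \<eta>) = (\<lambda>y. poly p (tamed_exp \<epsilon> \<eta> y))"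
proof (induction vs)
  case Nil
  have "iter_deriv [] (tamed_exp \<epsilon> \<eta>) = (\<lambda>y. poly [:0, 1:] (tamed_exp \<epsilon> \<eta> y))"
    by (simp add: iter_deriv_def)
  then show ?case by blast
next
  case (Cons v vs)
  then obtain p where p: "iter_deriv vs (tamed_exp \<epsilon> \<eta>) = (\<lambda>y. poly p (tamed_exp \<epsilon> \<eta> y))" by blast
  have "((\<lambda>y. poly p (tamed_exp \<epsilon> \<eta> y)) has_derivative
          (\<lambda>v. poly (pderiv p) (tamed_exp \<epsilon> \<eta> y)
            * (tamed_exp \<epsilon> \<eta> y * (1 - \<epsilon> * tamed_exp \<epsilon> \<eta> y) * (v \<bullet> \<eta>)))) (at y)" for y
    using has_derivative_compose[OF tamed_exp_has_derivative[OF assms, of \<eta> y]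
        poly_DERIV[of p, THEN has_field_derivative_imp_has_derivative]] by simp
  note frechet = fun_cong[OF frechet_derivative_at[OF this], symmetric]
  have "iter_deriv (v # vs) (tamed_exp \<epsilon> \<eta>) =
      (\<lambda>y. frechet_derivative (iter_deriv vs (tamed_exp \<epsilon> \<eta>)) (at y) v)"
    by (simp add: iter_deriv_def)
  also have "\<dots> = (\<lambda>y. poly (smult (v \<bullet> \<eta>) (pderiv p * [:0, 1, - \<epsilon>:])) (tamed_exp \<epsilon> \<eta> y))"
    unfolding p frechet by (simp add: fun_eq_iff algebra_simps)
  finally have "iter_deriv (v # vs) (tamed_exp \<epsilon> \<eta>) =
      (\<lambda>y. poly (smult (v \<bullet> \<eta>) (pderiv p * [:0, 1, - \<epsilon>:])) (tamed_exp \<epsilon> \<eta> y))" .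
  then show ?case by blast
qed

lemma tamed_exp_Cb_infinity:
  assumes "0 < \<epsilon>"
  shows "tamed_exp \<epsilon> \<eta> \<in> Cb_infinity"
  unfolding Cb_infinity_def
proof (intro CollectI allI conjI)
  fix vs
  obtain p where p: "iter_deriv vs (tamed_exp \<epsilon> \<eta>) = (\<lambda>y. poly p (tamed_exp \<epsilon> \<eta> y))"
    using iter_deriv_tamed_exp[OF assms] by blast
  have "(\<lambda>y. poly p (tamed_exp \<epsilon> \<eta> y)) differentiable (at y)" for y
    unfolding differentiable_def
    by (rule exI, rule has_derivative_compose[OF tamed_exp_has_derivative[OF assms]
        poly_DERIV[of p, THEN has_field_derivative_imp_has_derivative]])
  then show "iter_deriv vs (tamed_exp \<epsilon> \<eta>) differentiable (at y)" for y by (simp add: p)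
  have "compact (poly p ` {0..1 / \<epsilon>})"
    by (intro compact_continuous_image continuous_intros) simp
  moreover have "range (iter_deriv vs (tamed_exp \<epsilon> \<eta>)) \<subseteq> poly p ` {0..1 / \<epsilon>}"
    using tamed_exp_bounds(1,2)[OF assms, of \<eta>] by (force simp: p intro: less_imp_le)
  ultimately show "bounded (range (iter_deriv vs (tamed_exp \<epsilon> \<eta>)))"
    by (meson compact_imp_bounded bounded_subset)
qed

lemma tamed_exp_measurable: "tamed_exp \<epsilon> \<eta> \<in> borel_measurable borel"
  unfolding tamed_exp_def[abs_def] by measurable


lemma tamed_exp_one_minus:
  assumes "0 < \<epsilon>"
  shows "tamed_exp \<epsilon> \<eta> y * (1 - \<epsilon> * tamed_exp \<epsilon> \<eta> y) = exp (y \<bullet> \<eta>) / (1 + \<epsilon> * exp (y \<bullet> \<eta>))\<^sup>2"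
proof -
  have "1 - \<epsilon> * tamed_exp \<epsilon> \<eta> y = 1 / (1 + \<epsilon> * exp (y \<bullet> \<eta>))"
    using tamed_exp_denominator[OF assms, of "y \<bullet> \<eta>"]
    by (simp add: tamed_exp_def diff_divide_eq_iff)
  then show ?thesis by (simp add: tamed_exp_def power2_eq_square)
qed

text \<open>With \<open>\<Phi> q = q / (1 + \<epsilon> q)\<close>, the first inequality is the tangent inequality
  \<open>\<Phi> (p q) - \<Phi> q \<le> \<Phi>' q * (p q - q)\<close> of a concave function, and the second one says that
  \<open>\<Phi>\<close> is 1-Lipschitz on the positive reals.\<close>
lemma tamed_exp_increment:
  assumes "0 < \<epsilon>"
  shows "tamed_exp \<epsilon> \<eta> (y + w) - tamed_exp \<epsilon> \<eta> y
           \<le> (exp (w \<bullet> \<eta>) - 1) * (tamed_exp \<epsilon> \<eta> y * (1 - \<epsilon> * tamed_exp \<epsilon> \<eta> y))"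
    and "\<bar>tamed_exp \<epsilon> \<eta> (y + w) - tamed_exp \<epsilon> \<eta> y\<bar> \<le> exp (y \<bullet> \<eta>) * \<bar>exp (w \<bullet> \<eta>) - 1\<bar>"
proof -
  define q where "q = exp (y \<bullet> \<eta>)"
  define p where "p = exp (w \<bullet> \<eta>)"
  have q: "0 < q" and p: "0 < p" by (auto simp: q_def p_def)
  have D: "1 < 1 + \<epsilon> * q" "1 < 1 + \<epsilon> * (q * p)" using assms q p by auto
  then have D0: "0 < 1 + \<epsilon> * q" "0 < 1 + \<epsilon> * (q * p)" by linarith+
  have "tamed_exp \<epsilon> \<eta> (y + w) - tamed_exp \<epsilon> \<eta> y = q * p / (1 + \<epsilon> * (q * p)) - q / (1 + \<epsilon> * q)"
    by (simp add: tamed_exp_def q_def p_def inner_add_left exp_add)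
  also have "\<dots> = ((p - 1) * q) / ((1 + \<epsilon> * (q * p)) * (1 + \<epsilon> * q))"
    using D by (subst diff_frac_eq) (auto simp: algebra_simps)
  finally have eq: "tamed_exp \<epsilon> \<eta> (y + w) - tamed_exp \<epsilon> \<eta> y
      = ((p - 1) * q) / ((1 + \<epsilon> * (q * p)) * (1 + \<epsilon> * q))" .
  have "((p - 1) * q) / ((1 + \<epsilon> * (q * p)) * (1 + \<epsilon> * q)) \<le> ((p - 1) * q) / ((1 + \<epsilon> * q) * (1 + \<epsilon> * q))"
  proof (cases "1 \<le> p")
    case True
    then show ?thesis using assms q D0
      by (intro divide_left_mono mult_right_mono mult_pos_pos) auto
  next
    case False
    then show ?thesis using assms p q D0
      by (intro divide_left_mono_neg mult_right_mono mult_pos_pos)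
        (auto simp: mult_le_0_iff mult_le_cancel_left1)
  qed
  then show "tamed_exp \<epsilon> \<eta> (y + w) - tamed_exp \<epsilon> \<eta> y
           \<le> (exp (w \<bullet> \<eta>) - 1) * (tamed_exp \<epsilon> \<eta> y * (1 - \<epsilon> * tamed_exp \<epsilon> \<eta> y))"
    unfolding eq tamed_exp_one_minus[OF assms]
    by (simp add: p_def q_def power2_eq_square)
  have "1 * 1 \<le> (1 + \<epsilon> * (q * p)) * (1 + \<epsilon> * q)" using D by (intro mult_mono) auto
  then have "\<bar>(p - 1) * q\<bar> / ((1 + \<epsilon> * (q * p)) * (1 + \<epsilon> * q)) \<le> \<bar>(p - 1) * q\<bar> / 1"
    by (intro divide_left_mono) auto
  then show "\<bar>tamed_exp \<epsilon> \<eta> (y + w) - tamed_exp \<epsilon> \<eta> y\<bar> \<le> exp (y \<bullet> \<eta>) * \<bar>exp (w \<bullet> \<eta>) - 1\<bar>"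
    unfolding eq using D q by (simp add: abs_mult p_def q_def mult.commute)
qed

text \<open>On a true exponential the rescaled operator acts as multiplication by
  \<open>hamiltonian \<mu> (h *\<^sub>R \<eta>) / h\<close>.  Integrating the tangent inequality shows that taming costs
  exactly the factor \<open>1 - \<epsilon> * tamed_exp \<epsilon> \<eta> y\<close>.  The Lipschitz bound supplies the
  integrability.\<close>
lemma jump_operator_tamed_exp_le:
  fixes \<mu> :: "'a::euclidean_space measure"
  assumes \<mu>: "sets \<mu> = sets borel" "\<And>\<xi>. integrable \<mu> (\<lambda>z. exp (z \<bullet> \<xi>) - 1)"
    and "0 < \<epsilon>" "0 < h"
  shows "1 / h * jump_operator \<mu> h (tamed_exp \<epsilon> \<eta>) y
    \<le> hamiltonian \<mu> (h *\<^sub>R \<eta>) / h * (tamed_exp \<epsilon> \<eta> y * (1 - \<epsilon> * tamed_exp \<epsilon> \<eta> y))"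
proof -
  note [measurable_cong] = \<mu>(1)
  note [measurable] = tamed_exp_measurable
  have [simp]: "(h *\<^sub>R z) \<bullet> \<eta> = z \<bullet> (h *\<^sub>R \<eta>)" for z by simp
  have "jump_operator \<mu> h (tamed_exp \<epsilon> \<eta>) y
      \<le> (\<integral>z. (exp (z \<bullet> (h *\<^sub>R \<eta>)) - 1) * (tamed_exp \<epsilon> \<eta> y * (1 - \<epsilon> * tamed_exp \<epsilon> \<eta> y)) \<partial>\<mu>)"
    unfolding jump_operator_def
  proof (rule integral_mono)
    show "integrable \<mu> (\<lambda>z. tamed_exp \<epsilon> \<eta> (y + h *\<^sub>R z) - tamed_exp \<epsilon> \<eta> y)"
    proof (rule Bochner_Integration.integrable_bound)
      show "integrable \<mu> (\<lambda>z. exp (y \<bullet> \<eta>) * (exp (z \<bullet> (h *\<^sub>R \<eta>)) - 1))"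
        using \<mu>(2) by (rule integrable_mult_right)
      show "AE z in \<mu>. norm (tamed_exp \<epsilon> \<eta> (y + h *\<^sub>R z) - tamed_exp \<epsilon> \<eta> y)
          \<le> norm (exp (y \<bullet> \<eta>) * (exp (z \<bullet> (h *\<^sub>R \<eta>)) - 1))"
        using tamed_exp_increment(2)[OF assms(3), of \<eta> y "h *\<^sub>R _"] by (simp add: abs_mult)
    qed measurable
    show "integrable \<mu> (\<lambda>z. (exp (z \<bullet> (h *\<^sub>R \<eta>)) - 1) * (tamed_exp \<epsilon> \<eta> y * (1 - \<epsilon> * tamed_exp \<epsilon> \<eta> y)))"
      using \<mu>(2) by (rule integrable_mult_left)
    show "tamed_exp \<epsilon> \<eta> (y + h *\<^sub>R z) - tamed_exp \<epsilon> \<eta> y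
        \<le> (exp (z \<bullet> (h *\<^sub>R \<eta>)) - 1) * (tamed_exp \<epsilon> \<eta> y * (1 - \<epsilon> * tamed_exp \<epsilon> \<eta> y))" for z
      using tamed_exp_increment(1)[OF assms(3), of \<eta> y "h *\<^sub>R z"] by simp
  qed
  also have "\<dots> = hamiltonian \<mu> (h *\<^sub>R \<eta>) * (tamed_exp \<epsilon> \<eta> y * (1 - \<epsilon> * tamed_exp \<epsilon> \<eta> y))"
    unfolding hamiltonian_def by simp
  finally have "jump_operator \<mu> h (tamed_exp \<epsilon> \<eta>) y
    \<le> hamiltonian \<mu> (h *\<^sub>R \<eta>) * (tamed_exp \<epsilon> \<eta> y * (1 - \<epsilon> * tamed_exp \<epsilon> \<eta> y))" .
  from mult_left_mono[OF this, of "1 / h"] show ?thesis using \<open>0 < h\<close> by simp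
qed

lemma tamed_exp_power2_le:
  assumes "0 < \<epsilon>"
  shows "(tamed_exp \<epsilon> \<eta> y)\<^sup>2 \<le> tamed_exp (\<epsilon>\<^sup>2) (2 *\<^sub>R \<eta>) y"
proof -
  define q where "q = exp (y \<bullet> \<eta>)"
  have q: "0 < q" by (simp add: q_def)
  have "exp (y \<bullet> (2 *\<^sub>R \<eta>)) = q\<^sup>2" by (simp add: q_def exp_double)
  moreover have "q\<^sup>2 / (1 + \<epsilon> * q)\<^sup>2 \<le> q\<^sup>2 / (1 + \<epsilon>\<^sup>2 * q\<^sup>2)"
    using q assms by (intro divide_left_mono mult_pos_pos) (auto simp: power2_sum power_mult_distrib add_pos_pos)
  ultimately show ?thesis by (simp add: tamed_exp_def q_def power_divide)
qed

section \<open>Exponential moments of the semigroup\<close>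

text \<open>A bound with the absolute value of the Hamiltonian: it has the wrong rate when the
  Hamiltonian is negative, but it is uniform in \<open>\<epsilon>\<close>, and this is what the error term of the sharp
  bound requires.\<close>
lemma semigroup_tamed_exp_le_crude:
  fixes \<mu> :: "'a::euclidean_space measure"
  assumes \<mu>: "sets \<mu> = sets borel" "\<And>\<xi>. integrable \<mu> (\<lambda>z. exp (z \<bullet> \<xi>) - 1)"
    and P: "markov_semigroup P" "generated_by P (\<lambda>f y. 1 / h * jump_operator \<mu> h f y)"
    and "0 < h" "0 < \<epsilon>" "0 \<le> t"
  shows "(\<integral>y. tamed_exp \<epsilon> \<eta> y \<partial>P t x) \<le> exp (\<bar>hamiltonian \<mu> (h *\<^sub>R \<eta>) / h\<bar> * t) * exp (x \<bullet> \<eta>)"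
proof -
  define \<beta> where "\<beta> = hamiltonian \<mu> (h *\<^sub>R \<eta>) / h"
  note b = tamed_exp_bounds[OF \<open>0 < \<epsilon>\<close>, of \<eta>]
  have A: "1 / h * jump_operator \<mu> h (tamed_exp \<epsilon> \<eta>) y \<le> \<bar>\<beta>\<bar> * tamed_exp \<epsilon> \<eta> y + 0" for y
  proof -
    have "0 \<le> tamed_exp \<epsilon> \<eta> y * (1 - \<epsilon> * tamed_exp \<epsilon> \<eta> y)"
      by (subst tamed_exp_one_minus[OF \<open>0 < \<epsilon>\<close>]) simp
    moreover have "tamed_exp \<epsilon> \<eta> y * (1 - \<epsilon> * tamed_exp \<epsilon> \<eta> y) \<le> tamed_exp \<epsilon> \<eta> y"
      using b(1)[of y] \<open>0 < \<epsilon>\<close> by (simp add: mult_le_cancel_left1)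
    ultimately have "\<beta> * (tamed_exp \<epsilon> \<eta> y * (1 - \<epsilon> * tamed_exp \<epsilon> \<eta> y)) \<le> \<bar>\<beta>\<bar> * tamed_exp \<epsilon> \<eta> y"
      by (intro mult_mono) auto
    then show ?thesis
      using jump_operator_tamed_exp_le[OF \<mu> \<open>0 < \<epsilon>\<close> \<open>0 < h\<close>, of \<eta> y] by (simp add: \<beta>_def)
  qed
  have "(\<integral>y. tamed_exp \<epsilon> \<eta> y \<partial>P t x) \<le> exp (\<bar>\<beta>\<bar> * t) * tamed_exp \<epsilon> \<eta> x + t * exp (\<bar>\<bar>\<beta>\<bar>\<bar> * t) * 0"
    by (rule semigroup_gronwall[OF P tamed_exp_Cb_infinity[OF \<open>0 < \<epsilon>\<close>] _ _ _ A \<open>0 \<le> t\<close>, where B=0])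
      (use b(1) in \<open>auto intro: less_imp_le\<close>)
  also have "\<dots> \<le> exp (\<bar>\<beta>\<bar> * t) * exp (x \<bullet> \<eta>)"
    using b(3)[of x] by simp
  finally show ?thesis by (simp add: \<beta>_def)
qed

text \<open>For \<open>\<beta> < 0\<close> the factor \<open>1 - \<epsilon> f\<close>, \<open>f = tamed_exp \<epsilon> \<eta>\<close>, cannot be dropped from
  \<open>A f \<le> \<beta> f (1 - \<epsilon> f)\<close>, since the exponential decay of \<open>P t f\<close> fails where \<open>f\<close> saturates
  and is nearly constant.  So \<open>\<bar>\<beta>\<bar> \<epsilon> f\<^sup>2\<close> is carried as an error.  As \<open>f\<^sup>2\<close> is
  dominated by a tamed exponential with covector \<open>2 *\<^sub>R \<eta>\<close>, the crude bound makes this error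
  \<open>O(\<epsilon>)\<close>.\<close>
lemma semigroup_tamed_exp_le:
  fixes \<mu> :: "'a::euclidean_space measure"
  assumes \<mu>: "sets \<mu> = sets borel" "\<And>\<xi>. integrable \<mu> (\<lambda>z. exp (z \<bullet> \<xi>) - 1)"
    and P: "markov_semigroup P" "generated_by P (\<lambda>f y. 1 / h * jump_operator \<mu> h f y)"
    and "0 < h" "0 \<le> t"
  shows "\<exists>K. \<forall>\<epsilon>>0. (\<integral>y. tamed_exp \<epsilon> \<eta> y \<partial>P t x)
           \<le> exp (hamiltonian \<mu> (h *\<^sub>R \<eta>) / h * t) * exp (x \<bullet> \<eta>) + K * \<epsilon>"
proof -
  define \<beta> where "\<beta> = hamiltonian \<mu> (h *\<^sub>R \<eta>) / h"
  define \<beta>' where "\<beta>' = hamiltonian \<mu> (h *\<^sub>R (2 *\<^sub>R \<eta>)) / h"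
  define M where "M = exp (\<bar>\<beta>'\<bar> * t) * exp (x \<bullet> (2 *\<^sub>R \<eta>))"
  have "(\<integral>y. tamed_exp \<epsilon> \<eta> y \<partial>P t x)
      \<le> exp (\<beta> * t) * exp (x \<bullet> \<eta>) + (t * exp (\<bar>\<beta>\<bar> * t) * (\<bar>\<beta>\<bar> * M)) * \<epsilon>" if \<epsilon>: "0 < \<epsilon>" for \<epsilon>
  proof -
    note b = tamed_exp_bounds[OF \<epsilon>, of \<eta>]
    define e where "e y = \<bar>\<beta>\<bar> * \<epsilon> * (tamed_exp \<epsilon> \<eta> y)\<^sup>2" for y
    have sq: "(tamed_exp \<epsilon> \<eta> y)\<^sup>2 \<le> (1 / \<epsilon>)\<^sup>2" for y
      using b(1,2)[of y] by (intro power_mono) auto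
    have sq_m: "(\<lambda>y. (tamed_exp \<epsilon> \<eta> y)\<^sup>2) \<in> borel_measurable borel"
      using tamed_exp_measurable by measurable
    have A: "1 / h * jump_operator \<mu> h (tamed_exp \<epsilon> \<eta>) y \<le> \<beta> * tamed_exp \<epsilon> \<eta> y + e y" for y
    proof -
      have "- \<beta> * (\<epsilon> * (tamed_exp \<epsilon> \<eta> y)\<^sup>2) \<le> \<bar>\<beta>\<bar> * (\<epsilon> * (tamed_exp \<epsilon> \<eta> y)\<^sup>2)"
        using \<epsilon> by (intro mult_right_mono) auto
      then show ?thesis
        using jump_operator_tamed_exp_le[OF \<mu> \<epsilon> \<open>0 < h\<close>, of \<eta> y]
        by (simp add: \<beta>_def e_def power2_eq_square algebra_simps)
    qed
    have "(\<integral>y. tamed_exp \<epsilon> \<eta> y \<partial>P t x)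
        \<le> exp (\<beta> * t) * tamed_exp \<epsilon> \<eta> x + t * exp (\<bar>\<beta>\<bar> * t) * (\<bar>\<beta>\<bar> * \<epsilon> * M)"
    proof (rule semigroup_gronwall[OF P tamed_exp_Cb_infinity[OF \<epsilon>] _ _ _ A \<open>0 \<le> t\<close>])
      show "e \<in> borel_measurable borel" using sq_m by (simp add: e_def[abs_def])
      show "\<bar>e y\<bar> \<le> \<bar>\<beta>\<bar> * \<epsilon> * (1 / \<epsilon>)\<^sup>2" for y
        using sq[of y] \<epsilon> by (simp add: e_def abs_mult mult_left_mono)
      fix s assume s: "0 \<le> s" "s \<le> t"
      have \<epsilon>2: "0 < \<epsilon>\<^sup>2" using \<epsilon> by simp
      have "(\<integral>y. (tamed_exp \<epsilon> \<eta> y)\<^sup>2 \<partial>P s x) \<le> (\<integral>y. tamed_exp (\<epsilon>\<^sup>2) (2 *\<^sub>R \<eta>) y \<partial>P s x)"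
      proof (rule integral_mono)
        show "integrable (P s x) (\<lambda>y. (tamed_exp \<epsilon> \<eta> y)\<^sup>2)"
          using sq by (intro markov_semigroup_integrable[OF P(1) s(1) sq_m, where B="(1 / \<epsilon>)\<^sup>2"]) simp
        show "integrable (P s x) (tamed_exp (\<epsilon>\<^sup>2) (2 *\<^sub>R \<eta>))"
          using tamed_exp_bounds(1,2)[OF \<epsilon>2, of "2 *\<^sub>R \<eta>"]
          by (intro markov_semigroup_integrable[OF P(1) s(1) tamed_exp_measurable, where B="1 / \<epsilon>\<^sup>2"])
            (simp add: abs_of_pos)
      qed (rule tamed_exp_power2_le[OF \<epsilon>])
      also have "\<dots> \<le> exp (\<bar>\<beta>'\<bar> * s) * exp (x \<bullet> (2 *\<^sub>R \<eta>))"
        unfolding \<beta>'_def by (rule semigroup_tamed_exp_le_crude[OF \<mu> P \<open>0 < h\<close> \<epsilon>2 s(1)])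
      also have "\<dots> \<le> M" unfolding M_def using s by (intro mult_right_mono) (auto intro: mult_left_mono)
      finally have "(\<integral>y. (tamed_exp \<epsilon> \<eta> y)\<^sup>2 \<partial>P s x) \<le> M" .
      then show "(\<integral>y. e y \<partial>P s x) \<le> \<bar>\<beta>\<bar> * \<epsilon> * M"
        unfolding e_def using \<epsilon> by (simp add: mult_left_mono)
    qed (use b(1) \<epsilon> in \<open>auto intro: less_imp_le simp: M_def\<close>)
    also have "exp (\<beta> * t) * tamed_exp \<epsilon> \<eta> x \<le> exp (\<beta> * t) * exp (x \<bullet> \<eta>)"
      using b(3)[of x] by simp
    finally show ?thesis by (simp add: mult_ac)
  qed
  then show ?thesis unfolding \<beta>_def by blast
qed

text \<open>Fatou's lemma along \<open>\<epsilon> = 1 / (n + 1)\<close> removes the taming.\<close>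
lemma semigroup_exponential_moment:
  fixes \<mu> :: "'a::euclidean_space measure"
  assumes \<mu>: "sets \<mu> = sets borel" "\<And>\<xi>. integrable \<mu> (\<lambda>z. exp (z \<bullet> \<xi>) - 1)"
    and P: "markov_semigroup P" "generated_by P (\<lambda>f y. 1 / h * jump_operator \<mu> h f y)"
    and "0 < h" "0 \<le> t"
  shows "(\<integral>\<^sup>+y. ennreal (exp (y \<bullet> \<eta>)) \<partial>P t x)
           \<le> ennreal (exp (hamiltonian \<mu> (h *\<^sub>R \<eta>) / h * t) * exp (x \<bullet> \<eta>))"
proof -
  define m where "m = exp (hamiltonian \<mu> (h *\<^sub>R \<eta>) / h * t) * exp (x \<bullet> \<eta>)"
  from semigroup_tamed_exp_le[OF assms, of x \<eta>]
  obtain K where "\<forall>\<epsilon>>0. (\<integral>y. tamed_exp \<epsilon> \<eta> y \<partial>P t x) \<le> m + K * \<epsilon>"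
    unfolding m_def by (rule exE)
  then have K: "(\<integral>y. tamed_exp \<epsilon> \<eta> y \<partial>P t x) \<le> m + K * \<epsilon>" if "0 < \<epsilon>" for \<epsilon>
    using that by simp
  define \<epsilon> where "\<epsilon> n = inverse (real (Suc n))" for n
  have \<epsilon>: "0 < \<epsilon> n" for n by (simp add: \<epsilon>_def)
  have \<epsilon>0: "\<epsilon> \<longlonglongrightarrow> 0" unfolding \<epsilon>_def by (rule LIMSEQ_inverse_real_of_nat)
  have sets: "sets (P t x) = sets borel" using markov_semigroup_prob_space[OF P(1) \<open>0 \<le> t\<close>] by simp
  note [measurable_cong] = sets
  note [measurable] = tamed_exp_measurable
  have "(\<lambda>n. tamed_exp (\<epsilon> n) \<eta> y) \<longlonglongrightarrow> exp (y \<bullet> \<eta>) / (1 + 0 * exp (y \<bullet> \<eta>))" for y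
    unfolding tamed_exp_def by (intro tendsto_intros \<epsilon>0) simp
  then have "(\<lambda>n. tamed_exp (\<epsilon> n) \<eta> y) \<longlonglongrightarrow> exp (y \<bullet> \<eta>)" for y by simp
  then have "liminf (\<lambda>n. ennreal (tamed_exp (\<epsilon> n) \<eta> y)) = ennreal (exp (y \<bullet> \<eta>))" for y
    by (intro lim_imp_Liminf[OF sequentially_bot] tendsto_ennrealI)
  then have "(\<integral>\<^sup>+y. ennreal (exp (y \<bullet> \<eta>)) \<partial>P t x)
      = (\<integral>\<^sup>+y. liminf (\<lambda>n. ennreal (tamed_exp (\<epsilon> n) \<eta> y)) \<partial>P t x)" by simp
  also have "\<dots> \<le> liminf (\<lambda>n. \<integral>\<^sup>+y. ennreal (tamed_exp (\<epsilon> n) \<eta> y) \<partial>P t x)"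
    by (rule nn_integral_liminf) simp
  also have "\<dots> \<le> liminf (\<lambda>n. ennreal (m + K * \<epsilon> n))"
  proof (intro Liminf_mono always_eventually allI)
    fix n
    have "integrable (P t x) (tamed_exp (\<epsilon> n) \<eta>)"
      using tamed_exp_bounds(1,2)[OF \<epsilon>, of n \<eta>]
      by (intro markov_semigroup_integrable[OF P(1) \<open>0 \<le> t\<close> tamed_exp_measurable, where B="1 / \<epsilon> n"])
        (simp add: abs_of_pos)
    then have "(\<integral>\<^sup>+y. ennreal (tamed_exp (\<epsilon> n) \<eta> y) \<partial>P t x) = ennreal (\<integral>y. tamed_exp (\<epsilon> n) \<eta> y \<partial>P t x)"
      using tamed_exp_bounds(1)[OF \<epsilon>, of n \<eta>] by (intro nn_integral_eq_integral) (auto intro: less_imp_le)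
    also have "\<dots> \<le> ennreal (m + K * \<epsilon> n)" using K[OF \<epsilon>] by (rule ennreal_leI)
    finally show "(\<integral>\<^sup>+y. ennreal (tamed_exp (\<epsilon> n) \<eta> y) \<partial>P t x) \<le> ennreal (m + K * \<epsilon> n)" .
  qed
  also have "\<dots> = ennreal m"
  proof (rule lim_imp_Liminf)
    have "(\<lambda>n. m + K * \<epsilon> n) \<longlonglongrightarrow> m + K * 0" by (intro tendsto_intros \<epsilon>0)
    then show "(\<lambda>n. ennreal (m + K * \<epsilon> n)) \<longlonglongrightarrow> ennreal m" using tendsto_ennrealI by fastforce
  qed simp
  finally show ?thesis by (simp add: m_def)
qed

text \<open>Chebyshev's inequality with the covector \<open>\<eta> = \<xi> / h\<close>; the number
  \<open>c \<bullet> \<eta> - r * norm \<eta>\<close> is the minimum of \<open>y \<bullet> \<eta>\<close> over the ball.\<close>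
lemma semigroup_cball_le:
  fixes \<mu> :: "'a::euclidean_space measure"
  assumes \<mu>: "sets \<mu> = sets borel" "\<And>\<xi>. integrable \<mu> (\<lambda>z. exp (z \<bullet> \<xi>) - 1)"
    and P: "markov_semigroup P" "generated_by P (\<lambda>f y. 1 / h * jump_operator \<mu> h f y)"
    and h: "0 < h"
  shows "measure (P 1 x) (cball c r)
           \<le> exp (- ((c - x) \<bullet> \<xi> - r * norm \<xi> - hamiltonian \<mu> \<xi>) / h)"
proof -
  interpret prob_space "P 1 x" using markov_semigroup_prob_space[OF P(1)] by simp
  have [measurable_cong]: "sets (P 1 x) = sets borel"
    using markov_semigroup_prob_space[OF P(1)] by simp
  define \<eta> where "\<eta> = (1 / h) *\<^sub>R \<xi>"
  have \<xi>: "\<xi> = h *\<^sub>R \<eta>" using h by (simp add: \<eta>_def)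
  define m where "m = exp (c \<bullet> \<eta> - r * norm \<eta>)"
  define b where "b = exp (hamiltonian \<mu> \<xi> / h * 1) * exp (x \<bullet> \<eta>)"
  have "ennreal m * emeasure (P 1 x) (cball c r) = (\<integral>\<^sup>+y. ennreal m * indicator (cball c r) y \<partial>P 1 x)"
    by (rule nn_integral_cmult_indicator[symmetric]) simp
  also have "\<dots> \<le> (\<integral>\<^sup>+y. ennreal (exp (y \<bullet> \<eta>)) \<partial>P 1 x)"
  proof (rule nn_integral_mono)
    fix y
    have "m \<le> exp (y \<bullet> \<eta>)" if y: "y \<in> cball c r"
    proof -
      have "c \<bullet> \<eta> - y \<bullet> \<eta> = (c - y) \<bullet> \<eta>" by (simp add: inner_diff_left)
      also have "\<dots> \<le> norm (c - y) * norm \<eta>" by (rule norm_cauchy_schwarz)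
      also have "\<dots> \<le> r * norm \<eta>" using y by (intro mult_right_mono) (auto simp: dist_norm)
      finally show ?thesis by (simp add: m_def)
    qed
    then show "ennreal m * indicator (cball c r) y \<le> ennreal (exp (y \<bullet> \<eta>))"
      by (auto split: split_indicator intro: ennreal_leI)
  qed
  also have "\<dots> \<le> ennreal b"
    unfolding b_def \<xi> by (rule semigroup_exponential_moment[OF \<mu> P h]) simp
  finally have "ennreal (m * measure (P 1 x) (cball c r)) \<le> ennreal b"
    by (simp add: emeasure_eq_measure ennreal_mult m_def)
  then have "m * measure (P 1 x) (cball c r) \<le> b"
    by (subst (asm) ennreal_le_iff) (auto simp: b_def)
  then have "measure (P 1 x) (cball c r) \<le> b / m"
    by (simp add: m_def pos_le_divide_eq mult.commute)
  also have "b / m = exp (hamiltonian \<mu> \<xi> / h + x \<bullet> \<eta> - (c \<bullet> \<eta> - r * norm \<eta>))"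
    by (simp add: b_def m_def exp_add exp_diff)
  also have "hamiltonian \<mu> \<xi> / h + x \<bullet> \<eta> - (c \<bullet> \<eta> - r * norm \<eta>)
      = - ((c - x) \<bullet> \<xi> - r * norm \<xi> - hamiltonian \<mu> \<xi>) / h"
    using h by (simp add: \<eta>_def inner_diff_left field_simps)
  finally show ?thesis .
qed

section \<open>Duality and the estimate on balls\<close>

lemma convex_on_hamiltonian:
  fixes \<mu> :: "'a::euclidean_space measure"
  assumes \<mu>: "\<And>\<xi>. integrable \<mu> (\<lambda>z. exp (z \<bullet> \<xi>) - 1)"
  shows "convex_on UNIV (hamiltonian \<mu>)"
proof (rule convex_onI)
  fix t :: real and \<xi> \<zeta> :: 'a
  assume t: "0 < t" "t < 1"
  have "hamiltonian \<mu> ((1 - t) *\<^sub>R \<xi> + t *\<^sub>R \<zeta>)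
      \<le> (\<integral>z. (1 - t) * (exp (z \<bullet> \<xi>) - 1) + t * (exp (z \<bullet> \<zeta>) - 1) \<partial>\<mu>)"
    unfolding hamiltonian_def
  proof (rule integral_mono)
    fix z
    have "exp ((1 - t) *\<^sub>R (z \<bullet> \<xi>) + t *\<^sub>R (z \<bullet> \<zeta>)) \<le> (1 - t) * exp (z \<bullet> \<xi>) + t * exp (z \<bullet> \<zeta>)"
      using exp_convex t by (intro convex_onD[where A=UNIV]) auto
    then show "exp (z \<bullet> ((1 - t) *\<^sub>R \<xi> + t *\<^sub>R \<zeta>)) - 1
        \<le> (1 - t) * (exp (z \<bullet> \<xi>) - 1) + t * (exp (z \<bullet> \<zeta>) - 1)"
      by (simp add: inner_add_right algebra_simps)
  qed (use \<mu> in auto)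
  also have "\<dots> = (1 - t) * hamiltonian \<mu> \<xi> + t * hamiltonian \<mu> \<zeta>"
    unfolding hamiltonian_def using \<mu> by simp
  finally show "hamiltonian \<mu> ((1 - t) *\<^sub>R \<xi> + t *\<^sub>R \<zeta>)
      \<le> (1 - t) * hamiltonian \<mu> \<xi> + t * hamiltonian \<mu> \<zeta>" .
qed simp

text \<open>The minimax principle that exchanges the choice of the covector \<open>\<xi>\<close> and of the point
  \<open>a\<close> in the ball.  The hypothesis says that the concave support function
  \<open>\<sigma> \<xi> = b \<bullet> \<xi> - r * norm \<xi> = min {a \<bullet> \<xi> | a \<in> cball b r}\<close> lies below the convex function
  \<open>m + H\<close>.  A hyperplane separating the two graphs is the graph of an affine function
  \<open>a \<bullet> \<xi> + k'\<close> in between.  Since \<open>\<sigma>\<close> is positively homogeneous, its slope \<open>a\<close> must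
  belong to the ball, and \<open>k' \<ge> 0\<close>.\<close>
lemma convex_minimax_cball:
  fixes H :: "'a::euclidean_space \<Rightarrow> real"
  assumes H: "convex_on UNIV H" and r: "0 \<le> r"
    and le: "\<And>\<xi>. b \<bullet> \<xi> - r * norm \<xi> \<le> m + H \<xi>"
  shows "\<exists>a\<in>cball b r. \<forall>\<xi>. a \<bullet> \<xi> - H \<xi> \<le> m"
proof -
  define \<sigma> where "\<sigma> \<xi> = b \<bullet> \<xi> - r * norm \<xi>" for \<xi>
  define S where "S = {p. snd p < \<sigma> (fst p)}"
  define T where "T = {p. m + H (fst p) \<le> snd p}"
  have "convex S"
  proof (rule convexI)
    fix p q and u v :: real
    assume pq: "p \<in> S" "q \<in> S" and uv: "0 \<le> u" "0 \<le> v" "u + v = 1"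
    have "norm (u *\<^sub>R fst p + v *\<^sub>R fst q) \<le> u * norm (fst p) + v * norm (fst q)"
      using norm_triangle_ineq[of "u *\<^sub>R fst p" "v *\<^sub>R fst q"] uv by simp
    from mult_left_mono[OF this r]
    have "u * \<sigma> (fst p) + v * \<sigma> (fst q) \<le> \<sigma> (u *\<^sub>R fst p + v *\<^sub>R fst q)"
      by (simp add: \<sigma>_def inner_add_right algebra_simps)
    moreover have "u * snd p + v * snd q < u * \<sigma> (fst p) + v * \<sigma> (fst q)"
    proof (cases "u = 0")
      case True then show ?thesis using pq uv by (simp add: S_def)
    next
      case False
      then show ?thesis using pq uv
        by (intro add_less_le_mono mult_strict_left_mono mult_left_mono) (auto simp: S_def)
    qed
    ultimately show "u *\<^sub>R p + v *\<^sub>R q \<in> S" by (simp add: S_def)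
  qed
  moreover have "convex T"
  proof (rule convexI)
    fix p q and u v :: real
    assume pq: "p \<in> T" "q \<in> T" and uv: "0 \<le> u" "0 \<le> v" "u + v = 1"
    have "H (u *\<^sub>R fst p + v *\<^sub>R fst q) \<le> u * H (fst p) + v * H (fst q)"
      using H uv unfolding convex_on_def by blast
    moreover have "u * (m + H (fst p)) + v * (m + H (fst q)) \<le> u * snd p + v * snd q"
      using pq uv by (intro add_mono mult_left_mono) (auto simp: T_def)
    moreover have "u * (m + H (fst p)) + v * (m + H (fst q)) = (u + v) * m + (u * H (fst p) + v * H (fst q))"
      by (simp add: algebra_simps)
    ultimately show "u *\<^sub>R p + v *\<^sub>R q \<in> T" using uv by (simp add: T_def)
  qed
  moreover have "(0, - 1) \<in> S" "(0, m + H 0) \<in> T" by (auto simp: S_def T_def \<sigma>_def)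
  moreover have "S \<inter> T = {}" using le[folded \<sigma>_def]
    by (auto simp: S_def T_def) (meson le_less_trans not_le order_trans)
  ultimately obtain w k where w: "w \<noteq> 0" "\<forall>p\<in>S. w \<bullet> p \<le> k" "\<forall>p\<in>T. k \<le> w \<bullet> p"
    using separating_hyperplane_sets[of S T] by (metis empty_iff)
  obtain u s where us: "w = (u, s)" by fastforce
  have below: "u \<bullet> \<xi> + s * t \<le> k" if "t < \<sigma> \<xi>" for \<xi> t
    using w(2)[rule_format, of "(\<xi>, t)"] that by (simp add: S_def us)
  have above: "k \<le> u \<bullet> \<xi> + s * (m + H \<xi>)" for \<xi>
    using w(3)[rule_format, of "(\<xi>, m + H \<xi>)"] by (simp add: T_def us)
  \<comment> \<open>The hyperplane is not vertical: both sets project onto the whole space.\<close>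
  have "0 < s"
  proof (rule ccontr)
    assume "\<not> 0 < s"
    then consider "s < 0" | "s = 0" by linarith
    then show False
    proof cases
      case 1
      have "(\<bar>k\<bar> + 1) / s < \<sigma> 0" using 1 by (simp add: \<sigma>_def divide_pos_neg)
      from below[OF this] show False using 1 by simp
    next
      case 2
      have "u \<bullet> \<xi> = 0" for \<xi>
        using below[of "\<sigma> \<xi> - 1" \<xi>] below[of "\<sigma> 0 - 1" 0] above[of \<xi>] above[of 0] 2 by simp
      then have "u = 0" by (metis inner_eq_zero_iff)
      then show False using w(1) us 2 by (simp add: zero_prod_def)
    qed
  qed
  define a where "a = - (1 / s) *\<^sub>R u"
  define k' where "k' = k / s"
  have up: "a \<bullet> \<xi> + k' \<le> m + H \<xi>" for \<xi>
    using above[of \<xi>] \<open>0 < s\<close> by (simp add: a_def k'_def field_simps)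
  have low: "\<sigma> \<xi> \<le> a \<bullet> \<xi> + k'" for \<xi>
  proof (rule dense_le)
    fix t assume "t < \<sigma> \<xi>"
    from below[OF this] show "t \<le> a \<bullet> \<xi> + k'"
      using \<open>0 < s\<close> by (simp add: a_def k'_def field_simps)
  qed
  have k': "0 \<le> k'" using low[of 0] by (simp add: \<sigma>_def)
  have "a \<in> cball b r"
  proof (rule ccontr)
    assume "a \<notin> cball b r"
    then have "r < norm (b - a)" by (simp add: dist_norm)
    define n where "n = norm (b - a)"
    define D where "D = n * (n - r)"
    have D: "0 < D" unfolding D_def n_def using \<open>r < norm (b - a)\<close> r by (intro mult_pos_pos) auto
    \<comment> \<open>In the direction \<open>b - a\<close> the function \<open>\<sigma>\<close> grows faster than \<open>a\<close> by the rate \<open>D > 0\<close>,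
      hence exceeds it by more than \<open>k'\<close> far enough from the origin.\<close>
    define \<tau> where "\<tau> = (k' + 1) / D"
    have \<tau>: "0 < \<tau>" using D k' by (simp add: \<tau>_def)
    have "\<tau> * D = \<tau> * ((b - a) \<bullet> (b - a) - r * norm (b - a))"
      by (simp add: D_def n_def power2_norm_eq_inner[symmetric] power2_eq_square algebra_simps)
    also have "\<dots> = \<sigma> (\<tau> *\<^sub>R (b - a)) - a \<bullet> (\<tau> *\<^sub>R (b - a))"
    proof -
      have "norm (\<tau> *\<^sub>R (b - a)) = \<tau> * norm (b - a)" using \<tau> by simp
      then show ?thesis unfolding \<sigma>_def by (simp only: inner_scaleR_right) (simp add: inner_diff_left algebra_simps)
    qed
    also have "\<dots> \<le> k'" using low[of "\<tau> *\<^sub>R (b - a)"] by simp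
    finally show False using D by (simp add: \<tau>_def)
  qed
  moreover have "a \<bullet> \<xi> - H \<xi> \<le> m" for \<xi> using up[of \<xi>] k' by linarith
  ultimately show ?thesis by blast
qed

text \<open>The straight segment is an admissible curve.\<close>
lemma action_dist_le_lagrangian:
  "action_dist \<mu> x y \<le> e2ennreal (lagrangian \<mu> (y - x))"
proof -
  define \<phi> where "\<phi> t = x + t *\<^sub>R (y - x)" for t :: real
  have D: "(\<phi> has_vector_derivative (y - x)) (at t)" for t
    unfolding \<phi>_def by (auto intro!: derivative_eq_intros)
  have "\<phi> piecewise_C1_differentiable_on {0..1}"
  proof (rule C1_differentiable_imp_piecewise)
    show "\<phi> C1_differentiable_on {0..1}"
      unfolding C1_differentiable_on_def using D by (intro exI[of _ "\<lambda>_. y - x"]) auto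
  qed
  then have "\<phi> \<in> {\<phi>. \<phi> piecewise_C1_differentiable_on {0..1} \<and> \<phi> 0 = x \<and> \<phi> 1 = y}"
    by (simp add: \<phi>_def)
  then have "action_dist \<mu> x y \<le> action \<mu> \<phi>" unfolding action_dist_def by (rule INF_lower)
  also have "action \<mu> \<phi> = e2ennreal (lagrangian \<mu> (y - x))"
    using vector_derivative_at[OF D] by (simp add: action_def nn_integral_cmult)
  finally show ?thesis .
qed

text \<open>The estimate holds for every \<open>h\<close>, with no prefactor.  This uniformity is what allows one to pass
  from closed balls, where the minimax principle applies, to the open ball that they exhaust:
  a bound only asymptotic in \<open>h\<close> would lead to the infimum over the closed ball, which can be
  strictly smaller when the Lagrangian is infinite on the open one.\<close>
lemma semigroup_ball_le:
  fixes \<mu> :: "'a::euclidean_space measure"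
  assumes \<mu>: "sets \<mu> = sets borel" "\<And>\<xi>. integrable \<mu> (\<lambda>z. exp (z \<bullet> \<xi>) - 1)"
    and P: "markov_semigroup P" "generated_by P (\<lambda>f y. 1 / h * jump_operator \<mu> h f y)"
    and h: "0 < h" and r: "0 < r"
    and d: "\<And>y. y \<in> ball c r \<Longrightarrow> ennreal d < action_dist \<mu> x y"
  shows "measure (P 1 x) (ball c r) \<le> exp (- d / h)"
proof -
  interpret prob_space "P 1 x" using markov_semigroup_prob_space[OF P(1)] by simp
  have sets: "sets (P 1 x) = sets borel" using markov_semigroup_prob_space[OF P(1)] by simp
  have cball: "measure (P 1 x) (cball c s) \<le> exp (- d / h)" if s: "0 \<le> s" "s < r" for s
  proof -
    have "\<exists>\<xi>. d + hamiltonian \<mu> \<xi> < (c - x) \<bullet> \<xi> - s * norm \<xi>"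
    proof (rule ccontr)
      assume "\<not> ?thesis"
      then have "\<And>\<xi>. (c - x) \<bullet> \<xi> - s * norm \<xi> \<le> d + hamiltonian \<mu> \<xi>" by (simp add: not_less)
      from convex_minimax_cball[OF convex_on_hamiltonian[OF \<mu>(2)] s(1) this]
      obtain a where a: "a \<in> cball (c - x) s" "\<And>\<xi>. a \<bullet> \<xi> - hamiltonian \<mu> \<xi> \<le> d" by blast
      have "dist c (x + a) = dist (c - x) a" by (simp add: dist_norm algebra_simps)
      then have "x + a \<in> ball c r" using a(1) s by simp
      then have "ennreal d < action_dist \<mu> x (x + a)" by (rule d)
      also have "\<dots> \<le> e2ennreal (lagrangian \<mu> a)"
        using action_dist_le_lagrangian[of \<mu> x "x + a"] by simp
      also have "\<dots> \<le> e2ennreal (ereal d)"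
        unfolding lagrangian_def using a(2) by (intro e2ennreal_mono SUP_least) simp
      finally show False by simp
    qed
    then obtain \<xi> where \<xi>: "d + hamiltonian \<mu> \<xi> < (c - x) \<bullet> \<xi> - s * norm \<xi>" by blast
    have "measure (P 1 x) (cball c s) \<le> exp (- ((c - x) \<bullet> \<xi> - s * norm \<xi> - hamiltonian \<mu> \<xi>) / h)"
      by (rule semigroup_cball_le[OF \<mu> P h])
    also have "- ((c - x) \<bullet> \<xi> - s * norm \<xi> - hamiltonian \<mu> \<xi>) / h \<le> - d / h"
      using \<xi> h by (intro divide_right_mono) auto
    finally show ?thesis by simp
  qed
  define s where "s n = r - r * inverse (real (Suc n))" for n
  have s: "0 \<le> s n" "s n < r" for n using r by (auto simp: s_def field_simps)
  have "(\<lambda>n. r - r * inverse (real (Suc n))) \<longlonglongrightarrow> r - r * 0"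
    by (intro tendsto_intros LIMSEQ_inverse_real_of_nat)
  then have s_lim: "s \<longlonglongrightarrow> r" by (simp add: s_def[abs_def])
  have s_mono: "incseq s" unfolding s_def using r by (intro monoI diff_left_mono mult_left_mono le_imp_inverse_le) auto
  have Un: "(\<Union>n. cball c (s n)) = ball c r"
  proof (intro equalityI subsetI)
    fix y assume "y \<in> ball c r"
    then have "dist c y < r" by simp
    then have "\<forall>\<^sub>F n in sequentially. dist c y < s n" by (rule order_tendstoD(1)[OF s_lim])
    then obtain n where "dist c y < s n" by (auto simp: eventually_sequentially)
    then show "y \<in> (\<Union>n. cball c (s n))" by (auto intro: less_imp_le)
  qed (use s(2) in \<open>auto intro: le_less_trans\<close>)
  have "(\<lambda>n. measure (P 1 x) (cball c (s n))) \<longlonglongrightarrow> measure (P 1 x) (\<Union>n. cball c (s n))"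
    using s_mono by (intro finite_Lim_measure_incseq)
      (auto simp: sets incseq_def le_fun_def intro!: subset_cball)
  then show ?thesis unfolding Un using cball[OF s] by (intro LIMSEQ_le_const2) auto
qed

section \<open>Integrability for the image measure\<close>

lemma abs_exp_minus_one_le: "\<bar>exp w - 1\<bar> \<le> \<bar>w\<bar> * exp \<bar>w\<bar>" for w :: real
proof (cases "0 \<le> w")
  case True
  have "exp w * (1 - w) \<le> exp w * exp (- w)"
    using exp_ge_add_one_self[of "- w"] by (intro mult_left_mono) auto
  then show ?thesis using True by (simp add: exp_minus algebra_simps)
next
  case False
  have "1 - exp w \<le> - w * 1" using exp_ge_add_one_self[of w] by linarith
  also have "\<dots> \<le> - w * exp (- w)" using False by (intro mult_left_mono) auto
  finally show ?thesis using False by simp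
qed

lemma integrable_abs_powr_minus:
  assumes "\<alpha> < (1::real)"
  shows "integrable lborel (\<lambda>z. indicator {-1..1} z * \<bar>z\<bar> powr (- \<alpha>))"
proof -
  let ?f = "\<lambda>z. indicator {0..1} z * z powr (- \<alpha>) :: real"
  have "(\<lambda>z. z powr (- \<alpha>)) integrable_on {0..1}"
    using assms by (intro integrable_on_powr_from_0) auto
  then have "(\<lambda>z. z powr (- \<alpha>)) absolutely_integrable_on {0..1}"
    by (subst absolutely_integrable_on_iff_nonneg) auto
  then have f: "integrable lborel ?f"
    unfolding set_integrable_def by (subst (asm) integrable_completion) auto
  have "integrable lborel (\<lambda>z. ?f z + ?f (0 + (- 1) * z))"
    using f lborel_integrable_real_affine[OF f, of "- 1" 0] by (intro Bochner_Integration.integrable_add) auto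
  also have "(\<lambda>z. ?f z + ?f (0 + (- 1) * z)) = (\<lambda>z. indicator {-1..1} z * \<bar>z\<bar> powr (- \<alpha>))"
    by (auto simp: fun_eq_iff abs_if split: split_indicator)
  finally show ?thesis .
qed

text \<open>Jumps have finite first absolute moment: near \<open>0\<close> the integrand is a multiple of \<open>\<bar>z\<bar> powr (- \<alpha>)\<close>
  with \<open>\<alpha> < 1\<close>, and away from \<open>0\<close>, within the support, \<open>\<bar>z\<bar>\<close> is bounded by a multiple of
  \<open>min (z\<^sup>2) 1\<close>.  This is where \<open>\<alpha> < 1\<close> enters, and it explains why the Hamiltonian has no
  compensating drift term.\<close>
lemma integrable_abs_levy_density:
  fixes g :: "real \<Rightarrow> real"
  assumes g_nonneg: "\<And>z. z \<noteq> 0 \<Longrightarrow> 0 \<le> g z"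
    and g_supp: "\<And>z. z \<notin> {-1..1} \<Longrightarrow> g z = 0"
    and g_levy: "integrable lborel (\<lambda>z. min (z\<^sup>2) 1 * g z)"
    and C: "0 < C" and \<alpha>: "\<alpha> < 1"
    and g_near_0: "\<forall>\<^sub>F z in at 0. g z = C / \<bar>z\<bar> powr (1 + \<alpha>)"
  shows "g \<in> borel_measurable borel" and "integrable lborel (\<lambda>z. \<bar>z\<bar> * g z)"
proof -
  have [measurable]: "(\<lambda>z. min (z\<^sup>2) 1 * g z) \<in> borel_measurable borel"
    using borel_measurable_integrable[OF g_levy] by simp
  \<comment> \<open>The measurability of \<open>g\<close> is recovered by division, except at the point \<open>0\<close>.\<close>
  have "(\<lambda>z. if z = 0 then g 0 else (min (z\<^sup>2) 1 * g z) / min (z\<^sup>2) 1) \<in> borel_measurable borel"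
    by measurable
  also have "(\<lambda>z. if z = 0 then g 0 else (min (z\<^sup>2) 1 * g z) / min (z\<^sup>2) 1) = g"
    by (auto simp: fun_eq_iff min_def)
  finally show [measurable]: "g \<in> borel_measurable borel" .
  obtain d where d: "0 < d" "\<And>z. z \<noteq> 0 \<Longrightarrow> \<bar>z\<bar> < d \<Longrightarrow> g z = C / \<bar>z\<bar> powr (1 + \<alpha>)"
    using g_near_0 by (auto simp: eventually_at dist_real_def)
  define \<epsilon> where "\<epsilon> = min d 1"
  have \<epsilon>: "0 < \<epsilon>" "\<epsilon> \<le> d" "\<epsilon> \<le> 1" using d(1) by (auto simp: \<epsilon>_def)
  show "integrable lborel (\<lambda>z. \<bar>z\<bar> * g z)"
  proof (rule Bochner_Integration.integrable_bound)
    show "integrable lborel (\<lambda>z. C * (indicator {-1..1} z * \<bar>z\<bar> powr (- \<alpha>)) + 1 / \<epsilon>\<^sup>2 * (min (z\<^sup>2) 1 * g z))"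
      by (intro Bochner_Integration.integrable_add integrable_mult_right integrable_abs_powr_minus[OF \<alpha>] g_levy)
    have "\<bar>z\<bar> * g z \<le> C * (indicator {-1..1} z * \<bar>z\<bar> powr (- \<alpha>)) + 1 / \<epsilon>\<^sup>2 * (min (z\<^sup>2) 1 * g z)"
      if z: "z \<noteq> 0" for z
    proof -
      have n1: "0 \<le> C * (indicator {-1..1} z * \<bar>z\<bar> powr (- \<alpha>))" using C by simp
      have n2: "0 \<le> 1 / \<epsilon>\<^sup>2 * (min (z\<^sup>2) 1 * g z)" using g_nonneg[OF z] by simp
      consider "\<bar>z\<bar> < \<epsilon>" | "\<epsilon> \<le> \<bar>z\<bar>" "z \<in> {-1..1}" | "z \<notin> {-1..1}" by linarith
      then show ?thesis
      proof cases
        case 1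
        have "\<bar>z\<bar> * g z = C * (\<bar>z\<bar> / (\<bar>z\<bar> * \<bar>z\<bar> powr \<alpha>))" using d(2)[OF z] 1 \<epsilon> z by (simp add: powr_add)
        also have "\<dots> = C * (indicator {-1..1} z * \<bar>z\<bar> powr (- \<alpha>))"
        proof -
          have "z \<in> {-1..1}" using 1 \<epsilon> by auto
          then show ?thesis using z by (simp add: powr_minus_divide)
        qed
        finally show ?thesis using n2 by simp
      next
        case 2
        have "\<epsilon>\<^sup>2 \<le> \<bar>z\<bar>\<^sup>2" using 2 \<epsilon> by (intro power_mono) auto
        moreover have "\<epsilon>\<^sup>2 \<le> 1" using \<epsilon> by (simp add: power_le_one)
        ultimately have "1 \<le> 1 / \<epsilon>\<^sup>2 * min (z\<^sup>2) 1" using \<epsilon> by simp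
        then have "\<bar>z\<bar> \<le> 1 / \<epsilon>\<^sup>2 * min (z\<^sup>2) 1" using 2(2) by (simp add: abs_le_iff)
        from mult_right_mono[OF this g_nonneg[OF z]] show ?thesis using n1 by (simp add: mult.assoc)
      next
        case 3
        then show ?thesis using n1 n2 g_supp by simp
      qed
    qed
    then have "\<And>z. z \<noteq> 0 \<Longrightarrow> norm (\<bar>z\<bar> * g z) \<le> norm (C * (indicator {-1..1} z * \<bar>z\<bar> powr (- \<alpha>)) + 1 / \<epsilon>\<^sup>2 * (min (z\<^sup>2) 1 * g z))"
      using g_nonneg by (simp add: abs_mult) (smt (verit))
    then show "AE z in lborel. norm (\<bar>z\<bar> * g z) \<le> norm (C * (indicator {-1..1} z * \<bar>z\<bar> powr (- \<alpha>)) + 1 / \<epsilon>\<^sup>2 * (min (z\<^sup>2) 1 * g z))"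
      using AE_lborel_singleton[of "0::real"] by (auto elim: eventually_mono)
  qed measurable
qed

lemma curve_bound:
  fixes \<gamma> :: "real \<Rightarrow> 'a::euclidean_space"
  assumes "smooth_on_open UNIV \<gamma>" "bounded (range (nth_deriv 1 \<gamma>))" "\<gamma> 0 = 0"
  shows "continuous_on UNIV \<gamma>" and "\<exists>B\<ge>0. \<forall>z. norm (\<gamma> z) \<le> B * \<bar>z\<bar>"
proof -
  have "\<gamma> differentiable (at t)" for t
    using assms(1) unfolding smooth_on_open_def
    by (metis UNIV_I eq_id_iff funpow_0 nth_deriv_def)
  then have D: "(\<gamma> has_vector_derivative vector_derivative \<gamma> (at t)) (at t)" for t
    by (simp add: vector_derivative_works)
  then show "continuous_on UNIV \<gamma>"
    by (intro continuous_at_imp_continuous_on) (auto intro: has_vector_derivative_continuous)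
  obtain B where B: "\<And>t. norm (vector_derivative \<gamma> (at t)) \<le> B"
    using assms(2) by (auto simp: nth_deriv_def bounded_iff)
  have "norm (\<gamma> z - \<gamma> 0) \<le> B * norm (z - 0)" for z
  proof (rule differentiable_bound[where S=UNIV])
    show "(\<gamma> has_derivative (\<lambda>s. s *\<^sub>R vector_derivative \<gamma> (at t))) (at t within UNIV)" for t
      using D by (simp add: has_vector_derivative_def)
    show "onorm (\<lambda>s. s *\<^sub>R vector_derivative \<gamma> (at t)) \<le> B" for t
      using B[of t] by (intro onorm_bound) (auto simp: mult.commute[of B] intro: mult_left_mono order_trans[OF norm_ge_zero B])
  qed auto
  then have "norm (\<gamma> z) \<le> B * \<bar>z\<bar>" for z using assms(3) by simp
  moreover have "0 \<le> B" using B[of 0] norm_ge_zero order_trans by blast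
  ultimately show "\<exists>B\<ge>0. \<forall>z. norm (\<gamma> z) \<le> B * \<bar>z\<bar>" by blast
qed

text \<open>On the support of \<open>g\<close> the exponent is at most \<open>K = B * norm \<xi>\<close> in absolute value, and it
  is \<open>O(z)\<close> at \<open>0\<close>; hence so is \<open>exp (\<gamma> z \<bullet> \<xi>) - 1\<close>, which is integrable against a
  density with finite first absolute moment.\<close>
lemma integrable_exp_minus_one_image_measure:
  fixes \<gamma> :: "real \<Rightarrow> 'a::euclidean_space"
  assumes g: "g \<in> borel_measurable borel" "\<And>z. z \<noteq> 0 \<Longrightarrow> 0 \<le> g z"
    "\<And>z. z \<notin> {-1..1} \<Longrightarrow> g z = 0" "integrable lborel (\<lambda>z. \<bar>z\<bar> * g z)"
    and \<gamma>: "\<gamma> \<in> borel_measurable borel" "0 \<le> B" "\<And>z. norm (\<gamma> z) \<le> B * \<bar>z\<bar>"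
  shows "integrable (image_measure g \<gamma>) (\<lambda>z. exp (z \<bullet> \<xi>) - 1)"
proof -
  note [measurable] = g(1) \<gamma>(1)
  have nz: "AE z in lborel. z \<noteq> (0::real)" by (rule AE_lborel_singleton)
  define K where "K = B * norm \<xi>"
  have K: "0 \<le> K" using \<gamma>(2) by (simp add: K_def)
  have bound: "norm (g z * (exp (\<gamma> z \<bullet> \<xi>) - 1)) \<le> norm ((K * exp K) * (\<bar>z\<bar> * g z))" if z: "z \<noteq> 0" for z
  proof (cases "z \<in> {-1..1}")
    case True
    have "\<bar>\<gamma> z \<bullet> \<xi>\<bar> \<le> norm (\<gamma> z) * norm \<xi>" by (rule Cauchy_Schwarz_ineq2)
    also have "\<dots> \<le> B * \<bar>z\<bar> * norm \<xi>" using \<gamma>(3) by (intro mult_right_mono) auto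
    finally have w: "\<bar>\<gamma> z \<bullet> \<xi>\<bar> \<le> K * \<bar>z\<bar>" by (simp add: K_def mult_ac)
    also have "\<dots> \<le> K" using True K by (intro mult_left_le) auto
    finally have w': "\<bar>\<gamma> z \<bullet> \<xi>\<bar> \<le> K" .
    have "\<bar>exp (\<gamma> z \<bullet> \<xi>) - 1\<bar> \<le> \<bar>\<gamma> z \<bullet> \<xi>\<bar> * exp \<bar>\<gamma> z \<bullet> \<xi>\<bar>" by (rule abs_exp_minus_one_le)
    also have "\<dots> \<le> (K * \<bar>z\<bar>) * exp K" using w w' K by (intro mult_mono) auto
    finally have "g z * \<bar>exp (\<gamma> z \<bullet> \<xi>) - 1\<bar> \<le> g z * ((K * \<bar>z\<bar>) * exp K)"
      using g(2)[OF z] by (rule mult_left_mono)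
    then show ?thesis using g(2)[OF z] K by (simp add: abs_mult mult_ac)
  qed (simp add: g(3))
  have "integrable lborel (\<lambda>z. g z *\<^sub>R (exp (\<gamma> z \<bullet> \<xi>) - 1))"
  proof (rule Bochner_Integration.integrable_bound)
    show "integrable lborel (\<lambda>z. (K * exp K) * (\<bar>z\<bar> * g z))" using g(4) by (rule integrable_mult_right)
    show "AE z in lborel. norm (g z *\<^sub>R (exp (\<gamma> z \<bullet> \<xi>) - 1)) \<le> norm ((K * exp K) * (\<bar>z\<bar> * g z))"
      using nz by (rule eventually_mono) (use bound in simp)
  qed measurable
  then have "integrable (density lborel (\<lambda>z. ennreal (g z))) (\<lambda>z. exp (\<gamma> z \<bullet> \<xi>) - 1)"
    by (subst integrable_density) (use nz g(2) in \<open>auto elim: eventually_mono\<close>)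
  then show ?thesis unfolding image_measure_def by (subst integrable_distr_eq) auto
qed

section \<open>The upper bound of the large deviations\<close>

theorem theorem1:
  fixes g :: "real \<Rightarrow> real"
    and \<gamma> :: "real \<Rightarrow> 'a::euclidean_space"
    and C \<alpha> :: real
    and \<mu> :: "'a measure"
    and P :: "real \<Rightarrow> real \<Rightarrow> 'a \<Rightarrow> 'a measure"
    and x c :: 'a
    and r :: real
  assumes g_nonneg: "\<And>z. z \<noteq> 0 \<Longrightarrow> 0 \<le> g z"
    and g_smooth: "smooth_on_open (- {0}) g"
    and g_supp: "\<And>z. z \<notin> {-1..1} \<Longrightarrow> g z = 0"
    and g_levy: "integrable lborel (\<lambda>z. min (z\<^sup>2) 1 * g z)"
    and C: "0 < C" and \<alpha>: "0 < \<alpha>" "\<alpha> < 1"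
    and g_near_0: "\<forall>\<^sub>F z in at 0. g z = C / \<bar>z\<bar> powr (1 + \<alpha>)"
    and \<gamma>_smooth: "smooth_on_open UNIV \<gamma>"
    and \<gamma>_bounded: "\<And>n. n \<ge> 1 \<Longrightarrow> bounded (range (nth_deriv n \<gamma>))"
    and \<gamma>_0: "\<gamma> 0 = 0"
    and \<gamma>_span: "\<exists>k. span ((\<lambda>j. nth_deriv j \<gamma> 0) ` {..k}) = UNIV"
    and \<mu>_eq: "\<mu> = image_measure g \<gamma>"
    and semigroup: "\<And>h. h > 0 \<Longrightarrow> markov_semigroup (P h)"
    and generator: "\<And>h. h > 0 \<Longrightarrow> generated_by (P h) (\<lambda>f y. 1 / h * jump_operator \<mu> h f y)"
    and r: "0 < r"
  shows "Limsup (at_right 0) (\<lambda>h. ereal h * ext_ln (measure (P h 1 x) (ball c r)))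
           \<le> - enn2ereal (INF y\<in>ball c r. action_dist \<mu> x y)"
proof -
  define D where "D = (INF y\<in>ball c r. action_dist \<mu> x y)"
  let ?p = "\<lambda>h. measure (P h 1 x) (ball c r)"
  have sets: "sets \<mu> = sets borel" by (simp add: \<mu>_eq image_measure_def)
  obtain B where B: "0 \<le> B" "\<And>z. norm (\<gamma> z) \<le> B * \<bar>z\<bar>"
    using curve_bound(2)[OF \<gamma>_smooth \<gamma>_bounded \<gamma>_0] by auto
  have \<gamma>_m: "\<gamma> \<in> borel_measurable borel"
    using curve_bound(1)[OF \<gamma>_smooth \<gamma>_bounded \<gamma>_0] by (intro borel_measurable_continuous_onI) simp
  note g_int = integrable_abs_levy_density[OF g_nonneg g_supp g_levy C \<alpha>(2) g_near_0]
  have int: "integrable \<mu> (\<lambda>z. exp (z \<bullet> \<xi>) - 1)" for \<xi>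
    unfolding \<mu>_eq
    by (rule integrable_exp_minus_one_image_measure[OF g_int(1) g_nonneg g_supp g_int(2) \<gamma>_m B])
  have scaled_log: "ereal h * ext_ln (?p h) \<le> ereal (- d)" if h: "0 < h" and p: "?p h \<le> exp (- d / h)" for h d
  proof (cases "?p h = 0")
    case True
    then show ?thesis using h by (simp add: ext_ln_def)
  next
    case False
    then have "0 < ?p h" by (simp add: less_le)
    then have "ln (?p h) \<le> - d / h" using p by (metis ln_exp ln_mono exp_gt_zero)
    then have "h * ln (?p h) \<le> - d" using h by (simp add: field_simps)
    then show ?thesis using False by (simp add: ext_ln_def)
  qed
  have Limsup_le: "Limsup (at_right 0) (\<lambda>h. ereal h * ext_ln (?p h)) \<le> ereal (- d)"
    if p: "\<And>h. 0 < h \<Longrightarrow> ?p h \<le> exp (- d / h)" for d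
  proof (rule Limsup_bounded)
    show "\<forall>\<^sub>F h in at_right 0. ereal h * ext_ln (?p h) \<le> ereal (- d)"
      by (rule eventually_mono[OF eventually_at_right_less]) (use scaled_log p in blast)
  qed
  have ball: "Limsup (at_right 0) (\<lambda>h. ereal h * ext_ln (?p h)) \<le> ereal (- d)"
    if d: "ennreal d < D" for d
  proof (rule Limsup_le)
    fix h :: real assume h: "0 < h"
    show "?p h \<le> exp (- d / h)"
      using less_le_trans[OF d[unfolded D_def] INF_lower]
      by (rule semigroup_ball_le[OF sets int semigroup[OF h] generator[OF h] h r])
  qed
  have trivial: "Limsup (at_right 0) (\<lambda>h. ereal h * ext_ln (?p h)) \<le> 0"
  proof -
    have "?p h \<le> exp (- 0 / h)" if "0 < h" for h
      using prob_space.prob_le_1[OF markov_semigroup_prob_space(1)[OF semigroup[OF that]]] by simp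
    from Limsup_le[OF this] show ?thesis by (simp add: zero_ereal_def)
  qed
  \<comment> \<open>It is enough to compare with the numbers \<open>e\<close> below \<open>D\<close>, which also covers \<open>D = \<infinity>\<close>; a
    negative \<open>e\<close> is not the image of an extended nonnegative number and is treated apart.\<close>
  show ?thesis unfolding D_def[symmetric]
  proof (subst ereal_minus_le_minus[symmetric], simp only: ereal_uminus_uminus, rule dense_le)
    fix e :: ereal assume e: "e < enn2ereal D"
    show "e \<le> - Limsup (at_right 0) (\<lambda>h. ereal h * ext_ln (?p h))"
    proof (cases e)
      case (real d)
      show ?thesis
      proof (cases "0 \<le> d")
        case True
        have "ennreal d < D"
          using e True by (simp add: real less_ennreal.rep_eq enn2ereal_ennreal)
        from ball[OF this] show ?thesis unfolding real
          using ereal_minus_le_minus by fastforce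
      next
        case False
        then have "e \<le> 0" by (simp add: real)
        also have "0 \<le> - Limsup (at_right 0) (\<lambda>h. ereal h * ext_ln (?p h))"
          using trivial by simp
        finally show ?thesis .
      qed
    qed (use e in auto)
  qed
qed

end
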